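(* Let $m\ge 1$ be an integer, let $\mu\in\mathbb{R}$, and let $w$ be a vortex profile for $(m,\mu)$ (as defined in the context). Let $A$ be the linearized operator associated with $(m,\mu,w)$, regarded as an unbounded operator on $L^2(\mathbb{R}^2,\mathbb{C}^2)$ (as defined in the context). Then every eigenvalue $\lambda\in\mathbb{C}$ of $A$ satisfies $$|\operatorname{Re}\lambda|<3\max_{r>0}|w(r)|^2<3(\mu-m)<\infty .$$
   Context: Polar coordinates $(r,\theta)$ are used on $\mathbb{R}^2$. Vortex profile: for an integer $m\ge 1$ and $\mu\in\mathbb{R}$, a vortex profile is a positive function $w:(0,\infty)\to\mathbb{R}$ solving $$-w_{rr}-\tfrac1r w_r+\tfrac{m^2}{r^2}w+r^2w+2|w|^2w-2\mu w=0,\qquad r>0,$$ with $w(r)$ bounded as $r\to0^+$ and $w(r)\to0$ as $r\to\infty$, and with finite energy, i.e. $\psi(r,\theta)=e^{im\theta}w(r)$ satisfies $\int_{\mathbb{R}^2}\left[\tfrac12|\nabla\psi|^2+\left(\tfrac12r^2+|\psi|^2\right)|\psi|^2\right]dx<\infty$. Linearized operator: let $J=\begin{pmatrix}0&-1\\1&0\end{pmatrix}$, $R=\begin{pmatrix}1&0\\0&-1\end{pmatrix}$, and let $I$ be the $2\times2$ identity. Let $L_c$ be the unique self-adjoint operator on $L^2$ (of $\mathbb{R}^2$, complexified to have values in $\mathbb{C}^2$) associated with the closed nonnegative quadratic form $$q(\Psi,\Psi)=\int_{\mathbb{R}^2}\left[\tfrac12|\nabla\Psi|^2+\tfrac{r^2}{2}|\Psi|^2\right]dx,$$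 with form domain $\{\Psi\in H^1: r\Psi\in L^2\}$; thus $L_c\Psi=(-\tfrac12\Delta+\tfrac12r^2)\Psi$ in the sense of distributions for $\Psi\in D(L_c)$. Let $L_w$ be the bounded multiplication operator $L_w=2|w(r)|^2I+|w(r)|^2e^{2m\theta J}R-\mu I$. Define $A=-J(L_c+L_w)$ with domain $D(A)=D(L_c)$, regarded as an unbounded, closed, densely defined operator on $L^2(\mathbb{R}^2,\mathbb{C}^2)$. Equivalently, $$A\Phi=J\left[\tfrac12\Delta-\left(\tfrac12r^2-\mu+2|w|^2\right)-|w|^2e^{2m\theta J}R\right]\Phi .$$ *)

theory Defs
  imports "HOL-Analysis.Analysis"
begin

type_synonym field2 = "real^2 \<Rightarrow> complex^2"

definition pdiff :: "2 \<Rightarrow> (real^2 \<Rightarrow> 'a::real_normed_vector) \<Rightarrow> real^2 \<Rightarrow> 'a" where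
  "pdiff i f x = frechet_derivative f (at x) (axis i 1)"

text \<open>
  The angle is determined up to multiples of \<open>2 * pi\<close> (and arbitrary at the origin); it only
  enters through \<open>exp (\<i> * m * \<theta>)\<close> and \<open>exp (2 * m * \<theta> * J)\<close> with an integer \<open>m\<close>.
\<close>

definition polar_angle :: "real^2 \<Rightarrow> real" where
  "polar_angle x = Arg (Complex (x $ 1) (x $ 2))"


definition vortex_field :: "nat \<Rightarrow> (real \<Rightarrow> real) \<Rightarrow> real^2 \<Rightarrow> complex" where
  "vortex_field m w x = exp (\<i> * of_real (real m * polar_angle x)) * of_real (w (norm x))"

text \<open>
  Finite energy is integrability of the nonnegative energy density. The density is continuous
  away from the origin (a null set), so no measurability condition is hidden here.
\<close>

definition finite_energy :: "(real^2 \<Rightarrow> complex) \<Rightarrow> bool" where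
  "finite_energy \<psi> \<longleftrightarrow> integrable lborel (\<lambda>x.
     (1/2) * (\<Sum>i\<in>UNIV. (norm (pdiff i \<psi> x))\<^sup>2)
     + ((1/2) * (norm x)\<^sup>2 + (norm (\<psi> x))\<^sup>2) * (norm (\<psi> x))\<^sup>2)"

text \<open>Only the values of \<open>w\<close> on the open half-line matter.\<close>

definition vortex_profile :: "nat \<Rightarrow> real \<Rightarrow> (real \<Rightarrow> real) \<Rightarrow> bool" where
  "vortex_profile m \<mu> w \<longleftrightarrow>
     (\<forall>r>0. w r > 0) \<and>
     (\<exists>w' w''. \<forall>r>0.
        (w has_real_derivative w' r) (at r) \<and>
        (w' has_real_derivative w'' r) (at r) \<and>
        - w'' r - (1 / r) * w' r + ((real m)\<^sup>2 / r\<^sup>2) * w r + r\<^sup>2 * w r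
          + 2 * \<bar>w r\<bar>\<^sup>2 * w r - 2 * \<mu> * w r = 0) \<and>
     Bfun w (at_right 0) \<and>
     (w \<longlongrightarrow> 0) at_top \<and>
     finite_energy (vortex_field m w)"


definition cdot :: "complex^2 \<Rightarrow> complex^2 \<Rightarrow> complex" where
  "cdot u v = (\<Sum>i\<in>UNIV. u $ i * cnj (v $ i))"

text \<open>
  Elements of the Hilbert space are represented by square-integrable Borel functions; two
  representatives are identified when they agree almost everywhere.
\<close>

definition L2 :: "field2 set" where
  "L2 = {\<Psi> \<in> borel_measurable lborel. integrable lborel (\<lambda>x. (norm (\<Psi> x))\<^sup>2)}"

definition L2_inner :: "field2 \<Rightarrow> field2 \<Rightarrow> complex" where
  "L2_inner \<Psi> \<Phi> = (LINT x|lborel. cdot (\<Psi> x) (\<Phi> x))"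


primrec Ck :: "nat \<Rightarrow> (real^2 \<Rightarrow> real) \<Rightarrow> bool" where
  "Ck 0 f \<longleftrightarrow> continuous_on UNIV f"
| "Ck (Suc k) f \<longleftrightarrow> (\<forall>x. f differentiable (at x)) \<and> (\<forall>i. Ck k (pdiff i f))"

definition test_function :: "(real^2 \<Rightarrow> real) \<Rightarrow> bool" where
  "test_function \<phi> \<longleftrightarrow> (\<forall>k. Ck k \<phi>) \<and> compact (closure {x. \<phi> x \<noteq> 0})"

definition is_weak_pdiff :: "2 \<Rightarrow> field2 \<Rightarrow> field2 \<Rightarrow> bool" where
  "is_weak_pdiff i \<Psi> G \<longleftrightarrow>
     (\<forall>\<phi>. test_function \<phi> \<longrightarrow>
        (LINT x|lborel. pdiff i \<phi> x *\<^sub>R \<Psi> x) = - (LINT x|lborel. \<phi> x *\<^sub>R G x))"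

definition H1 :: "field2 set" where
  "H1 = {\<Psi> \<in> L2. \<forall>i. \<exists>G\<in>L2. is_weak_pdiff i \<Psi> G}"

text \<open>On \<open>H1\<close> the weak derivative is unique up to a null set; we choose a representative.\<close>

definition weak_pdiff :: "2 \<Rightarrow> field2 \<Rightarrow> field2" where
  "weak_pdiff i \<Psi> = (SOME G. G \<in> L2 \<and> is_weak_pdiff i \<Psi> G)"

definition form_domain :: "field2 set" where
  "form_domain = {\<Psi> \<in> H1. (\<lambda>x. norm x *\<^sub>R \<Psi> x) \<in> L2}"

text \<open>
  The sesquilinear form whose diagonal is the quadratic form
  \<open>\<integral> (1/2) |\<nabla>\<Psi>|\<^sup>2 + (r\<^sup>2/2) |\<Psi>|\<^sup>2\<close>.
\<close>

definition q_form :: "field2 \<Rightarrow> field2 \<Rightarrow> complex" where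
  "q_form \<Psi> \<Phi> = (LINT x|lborel.
     (1/2) * (\<Sum>i\<in>UNIV. cdot (weak_pdiff i \<Psi> x) (weak_pdiff i \<Phi> x))
     + of_real ((norm x)\<^sup>2 / 2) * cdot (\<Psi> x) (\<Phi> x))"

text \<open>
  Unbounded operators are given by their graphs: \<open>T \<Psi> F\<close> means that \<open>\<Psi>\<close> lies in the domain
  and \<open>F\<close> represents the value at \<open>\<Psi>\<close>. The self-adjoint operator associated with a closed,
  densely defined, nonnegative form \<open>(Q, q)\<close> (first representation theorem) has as domain all
  \<open>\<Psi> \<in> Q\<close> for which some \<open>F\<close> in the Hilbert space satisfies \<open>q(\<Psi>, \<Phi>) = \<langle>F, \<Phi>\<rangle>\<close> for all
  \<open>\<Phi> \<in> Q\<close>, and maps \<open>\<Psi>\<close> to this \<open>F\<close>.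
\<close>

definition form_operator ::
  "field2 set \<Rightarrow> (field2 \<Rightarrow> field2 \<Rightarrow> complex) \<Rightarrow> field2 \<Rightarrow> field2 \<Rightarrow> bool" where
  "form_operator Q q \<Psi> F \<longleftrightarrow>
     \<Psi> \<in> Q \<and> F \<in> L2 \<and> (\<forall>\<Phi>\<in>Q. q \<Psi> \<Phi> = L2_inner F \<Phi>)"

definition L_c :: "field2 \<Rightarrow> field2 \<Rightarrow> bool" where
  "L_c = form_operator form_domain q_form"


definition Jmat :: "complex^2^2" where
  "Jmat = vector [vector [0, -1], vector [1, 0]]"

definition Rmat :: "complex^2^2" where
  "Rmat = vector [vector [1, 0], vector [0, -1]]"

definition mat_exp :: "complex^2^2 \<Rightarrow> complex^2^2" where
  "mat_exp M = (\<Sum>n. (1 / fact n) *\<^sub>R (((**) M ^^ n) (mat 1)))"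

lemma Jmat_square: "Jmat ** Jmat = - mat 1"
  by (simp add: Jmat_def matrix_matrix_mult_def mat_def vec_eq_iff forall_2 sum_2)

lemma mat_exp_Jmat: "mat_exp (t *\<^sub>R Jmat) = cos t *\<^sub>R mat 1 + sin t *\<^sub>R Jmat"
proof -
  have pow: "((**) (t *\<^sub>R Jmat) ^^ n) (mat 1) =
      (fact n * (cos_coeff n * t ^ n)) *\<^sub>R mat 1 + (fact n * (sin_coeff n * t ^ n)) *\<^sub>R Jmat" for n
  proof (induction n)
    case 0
    show ?case by (simp add: cos_coeff_def sin_coeff_def)
  next
    case (Suc n)
    have mul: "(t *\<^sub>R Jmat) ** (a *\<^sub>R mat 1 + b *\<^sub>R Jmat) = (- (t * b)) *\<^sub>R mat 1 + (t * a) *\<^sub>R Jmat"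
      for a b
      by (simp add: Jmat_def matrix_matrix_mult_def mat_def vec_eq_iff forall_2 sum_2)
    have c: "fact (Suc n) * (cos_coeff (Suc n) * t ^ Suc n) = - (t * (fact n * (sin_coeff n * t ^ n)))"
      by (simp add: cos_coeff_Suc del: of_nat_Suc)
    have s: "fact (Suc n) * (sin_coeff (Suc n) * t ^ Suc n) = t * (fact n * (cos_coeff n * t ^ n))"
      by (simp add: sin_coeff_Suc del: of_nat_Suc)
    show ?case unfolding c s by (simp only: funpow.simps o_apply Suc.IH mul)
  qed
  have "(\<lambda>n. (cos_coeff n *\<^sub>R t ^ n) *\<^sub>R (mat 1 :: complex^2^2) + (sin_coeff n *\<^sub>R t ^ n) *\<^sub>R Jmat)
      sums (cos t *\<^sub>R mat 1 + sin t *\<^sub>R Jmat)"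
    by (intro sums_add bounded_linear.sums[OF bounded_linear_scaleR_left] cos_converges sin_converges)
  moreover have "(1 / fact n) *\<^sub>R (((**) (t *\<^sub>R Jmat) ^^ n) (mat 1)) =
      (cos_coeff n *\<^sub>R t ^ n) *\<^sub>R mat 1 + (sin_coeff n *\<^sub>R t ^ n) *\<^sub>R Jmat" for n
    by (simp add: pow scaleR_add_right)
  ultimately show ?thesis
    unfolding mat_exp_def by (simp add: sums_iff)
qed

definition L_w :: "nat \<Rightarrow> real \<Rightarrow> (real \<Rightarrow> real) \<Rightarrow> real^2 \<Rightarrow> complex^2^2" where
  "L_w m \<mu> w x =
     (2 * \<bar>w (norm x)\<bar>\<^sup>2) *\<^sub>R mat 1
     + \<bar>w (norm x)\<bar>\<^sup>2 *\<^sub>R (mat_exp ((2 * real m * polar_angle x) *\<^sub>R Jmat) ** Rmat)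
     - \<mu> *\<^sub>R mat 1"

definition lin_op :: "nat \<Rightarrow> real \<Rightarrow> (real \<Rightarrow> real) \<Rightarrow> field2 \<Rightarrow> field2 \<Rightarrow> bool" where
  "lin_op m \<mu> w \<Psi> G \<longleftrightarrow> G \<in> L2 \<and>
     (\<exists>F. L_c \<Psi> F \<and> (AE x in lborel. G x = - (Jmat *v (F x + L_w m \<mu> w x *v \<Psi> x))))"

definition eigenvalue :: "(field2 \<Rightarrow> field2 \<Rightarrow> bool) \<Rightarrow> complex \<Rightarrow> bool" where
  "eigenvalue T z \<longleftrightarrow>
     (\<exists>\<Psi>\<in>L2. \<not> (AE x in lborel. \<Psi> x = 0) \<and> T \<Psi> (\<lambda>x. z *s \<Psi> x))"

end

theory Submission
  imports Defs "HOL-Computational_Algebra.Polynomial"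
begin

text \<open>
  Pairing the eigenvalue equation \<open>z \<Psi> = - J (L\<^sub>c + L\<^sub>w) \<Psi>\<close> with \<open>\<Psi>\<close>, the form
  \<open>q(\<Psi>, J \<Psi>)\<close> is purely imaginary since \<open>J\<close> is antisymmetric and commutes with the weak
  derivatives; so is the contribution of the scalar part of \<open>L\<^sub>w\<close>. What remains is \<open>w\<^sup>2\<close> times a
  reflection, so \<open>\<bar>Re z\<bar>\<close> is controlled by the maximum of \<open>w\<^sup>2\<close>.

  The maximum is attained because \<open>w\<close> is nondecreasing near \<open>0\<close>. At a maximum point \<open>r\<^sub>0\<close> the
  profile equation gives \<open>2 w\<^sup>2 \<le> 2 \<mu> - (m\<^sup>2 / r\<^sub>0\<^sup>2 + r\<^sub>0\<^sup>2) \<le> 2 (\<mu> - m)\<close>. Equality forces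
  \<open>r\<^sub>0\<^sup>2 = m\<close> and \<open>w''(r\<^sub>0) = 0\<close>; then \<open>w(r\<^sub>0) - w(r) = o((r - r\<^sub>0)\<^sup>2)\<close>, whereas
  \<open>m\<^sup>2 / r\<^sup>2 + r\<^sup>2 - 2 m\<close> is at least \<open>(r - r\<^sub>0)\<^sup>2\<close> for \<open>r > r\<^sub>0\<close>, which makes
  \<open>r w'\<close> increase to the right of \<open>r\<^sub>0\<close>, a contradiction.
\<close>

subsection \<open>The maximum of a vortex profile\<close>

lemma vortex_profile_max:
  fixes w :: "real \<Rightarrow> real"
  assumes m: "m \<ge> 1" and vp: "vortex_profile m \<mu> w"
  obtains r0 where "r0 > 0" "\<And>r. r > 0 \<Longrightarrow> w r \<le> w r0" "(w r0)\<^sup>2 < \<mu> - real m"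
proof -
  have pos: "w r > 0" if "r > 0" for r
    using vp that by (auto simp: vortex_profile_def)
  obtain w' w'' where D1: "\<And>r. r > 0 \<Longrightarrow> (w has_real_derivative w' r) (at r)"
    and D2: "\<And>r. r > 0 \<Longrightarrow> (w' has_real_derivative w'' r) (at r)"
    and ode: "\<And>r. r > 0 \<Longrightarrow> - w'' r - (1 / r) * w' r + ((real m)\<^sup>2 / r\<^sup>2) * w r + r\<^sup>2 * w r
          + 2 * \<bar>w r\<bar>\<^sup>2 * w r - 2 * \<mu> * w r = 0"
    using vp unfolding vortex_profile_def by blast
  have lim: "(w \<longlongrightarrow> 0) at_top" and bdd: "Bfun w (at_right 0)"
    using vp by (auto simp: vortex_profile_def)
  \<comment> \<open>The profile equation becomes \<open>(r w')' = r w h\<close>; since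
    \<open>w > 0\<close>, the sign of \<open>h\<close> decides whether \<open>r w'\<close>
    increases.\<close>
  define h where "h = (\<lambda>r. (real m)\<^sup>2 / r\<^sup>2 + r\<^sup>2 + 2 * (w r)\<^sup>2 - 2 * \<mu>)"
  have ode': "w'' r = h r * w r - w' r / r" if "r > 0" for r
    using ode[OF that] by (simp add: h_def algebra_simps)
  have Drw: "((\<lambda>r. r * w' r) has_real_derivative r * w r * h r) (at r)" if "r > 0" for r
    using that by (auto intro!: derivative_eq_intros D2 simp: ode' field_simps)
  have cont: "continuous_on {a..b} w" if "a > 0" for a b
    using that by (intro DERIV_continuous_on[of _ _ w']) (auto intro!: DERIV_subset[OF D1])
  \<comment> \<open>Starting from \<open>a * w' a = 0\<close>, the quantity \<open>r w'\<close>
    increases strictly, so \<open>w'\<close> is positive inside the interval.\<close>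
  have incr: "w a < w b" if ab: "0 < a" "a < b" "\<And>r. a < r \<Longrightarrow> r < b \<Longrightarrow> h r > 0" "w' a = 0" for a b
  proof -
    have "w' r > 0" if r: "a < r" "r < b" for r
    proof -
      have "a * w' a < r * w' r"
      proof (rule DERIV_pos_imp_increasing_open[OF r(1)])
        fix x assume x: "a < x" "x < r"
        have "x * w x * h x > 0" using x r ab(1) ab(3)[of x] pos[of x] by simp
        then show "\<exists>y. ((\<lambda>r. r * w' r) has_real_derivative y) (at x) \<and> y > 0"
          using Drw[of x] x ab by (intro exI[of _ "x * w x * h x"]) auto
      next
        show "continuous_on {a..r} (\<lambda>r. r * w' r)"
          using ab
          by (intro DERIV_continuous_on[of _ _ "\<lambda>r. r * w r * h r"]) (auto intro!: DERIV_subset[OF Drw])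
      qed
      then show ?thesis using ab r by (simp add: zero_less_mult_iff)
    qed
    then show ?thesis
      using ab by (intro DERIV_pos_imp_increasing_open[of a b w]) (auto intro!: cont exI D1)
  qed
  obtain \<delta> where \<delta>: "\<delta> > 0" and hpos: "\<And>r. 0 < r \<Longrightarrow> r \<le> \<delta> \<Longrightarrow> h r > 0"
  proof
    \<comment> \<open>As \<open>\<delta> \<le> 1\<close>, any \<open>r \<le> \<delta>\<close> has
      \<open>r^2 \<le> \<delta>\<close>, hence
      \<open>1 / r^2 \<ge> 2 * \<bar>\<mu>\<bar> + 1\<close>; with \<open>m \<ge> 1\<close> the
      centrifugal term alone exceeds \<open>2 * \<mu>\<close>.\<close>
    define \<delta> where "\<delta> = 1 / (2 * \<bar>\<mu>\<bar> + 1)"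
    show "\<delta> > 0" by (simp add: \<delta>_def add_pos_nonneg add_nonneg_pos)
    fix r assume r: "0 < r" "r \<le> \<delta>"
    have d1: "\<delta> \<le> 1" by (simp add: \<delta>_def divide_simps)
    have "r\<^sup>2 \<le> \<delta>" using r d1 by (simp add: power2_eq_square) (metis mult_left_le less_eq_real_def mult.commute mult_mono order_trans mult_cancel_right1)
    then have "(2 * \<bar>\<mu>\<bar> + 1) * r\<^sup>2 \<le> 1"
      by (simp add: \<delta>_def divide_simps mult.commute split: if_splits)
    then have "2 * \<bar>\<mu>\<bar> + 1 \<le> 1 / r\<^sup>2" using r by (simp add: field_simps)
    also have "\<dots> \<le> (real m)\<^sup>2 / r\<^sup>2" using m r by (intro divide_right_mono) auto
    finally have "(real m)\<^sup>2 / r\<^sup>2 > 2 * \<mu>" by linarith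
    then show "h r > 0" unfolding h_def
      by (smt (verit) zero_le_power2)
  qed
  \<comment> \<open>Otherwise \<open>r w'\<close>, which increases near \<open>0\<close>, stays below a negative constant there,
     and \<open>w\<close> grows logarithmically as \<open>r \<rightarrow> 0\<close>.\<close>
  have w'_nonneg: "w' s \<ge> 0" if s: "0 < s" "s < \<delta>" for s
  proof (rule ccontr)
    assume neg: "\<not> w' s \<ge> 0"
    define a where "a = - (s * w' s)"
    have a: "a > 0" using neg s by (simp add: a_def mult_pos_neg)
    have le: "r * w' r \<le> - a" if r: "0 < r" "r \<le> s" for r
      unfolding a_def minus_minus
    proof (rule DERIV_nonneg_imp_nondecreasing[OF r(2)])
      fix x assume "r \<le> x" "x \<le> s"
      then show "\<exists>y. ((\<lambda>r. r * w' r) has_real_derivative y) (at x) \<and> y \<ge> 0"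
        using Drw[of x] r s hpos[of x] pos[of x] by (intro exI[of _ "x * w x * h x"]) auto
    qed
    \<comment> \<open>From \<open>r w' \<le> - a\<close> the function \<open>w + a ln r\<close> is
      nonincreasing on \<open>(0, s]\<close>, so \<open>w\<close> dominates \<open>- a ln r\<close>
      up to a constant.\<close>
    have log: "w s + a * ln s \<le> w r + a * ln r" if r: "0 < r" "r \<le> s" for r
    proof (rule DERIV_nonpos_imp_nonincreasing[OF r(2)])
      fix x assume x: "r \<le> x" "x \<le> s"
      have "((\<lambda>r. w r + a * ln r) has_real_derivative (w' x + a / x)) (at x)"
        using x r by (auto intro!: derivative_eq_intros D1)
      moreover have "w' x + a / x \<le> 0" using le[of x] x r by (simp add: field_simps)
      ultimately show "\<exists>y. ((\<lambda>r. w r + a * ln r) has_real_derivative y) (at x) \<and> y \<le> 0" by blast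
    qed
    obtain B where B: "eventually (\<lambda>r. norm (w r) \<le> B) (at_right 0)"
      using bdd by (auto simp: Bfun_def)
    have "eventually (\<lambda>r. w r + a * ln r < w s + a * ln s) (at_right 0)"
    proof -
      have "filterlim (\<lambda>r::real. a * ln r) at_bot (at_right 0)"
        by (intro filterlim_tendsto_pos_mult_at_bot[OF tendsto_const a ln_at_0])
      then have "eventually (\<lambda>r. a * ln r < w s + a * ln s - B) (at_right 0)"
        by (simp add: filterlim_at_bot_dense)
      with B show ?thesis by eventually_elim auto
    qed
    moreover have "eventually (\<lambda>r. r \<in> {0<..<s}) (at_right 0)"
      using s by (rule_tac eventually_at_right_real) auto
    ultimately have "eventually (\<lambda>r. False) (at_right (0::real))"
      by eventually_elim (use log in fastforce)
    then show False by simp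
  qed
  define s where "s = \<delta> / 2"
  have s: "0 < s" "s < \<delta>" using \<delta> by (auto simp: s_def)
  have mono: "w r \<le> w s" if "0 < r" "r \<le> s" for r
    using that s by (intro DERIV_nonneg_imp_nondecreasing[of r s w]) (auto intro!: exI D1 w'_nonneg)
  obtain R where R: "\<And>r. r \<ge> R \<Longrightarrow> w r < w s"
    using order_tendstoD(2)[OF lim pos[OF s(1)]] by (auto simp: eventually_at_top_linorder)
  \<comment> \<open>Left of \<open>s\<close> the profile is nondecreasing and beyond
    \<open>R\<close> it is below \<open>w s\<close>, so a maximum over this compact interval is
    global.\<close>
  have "\<exists>x\<in>{s..max s R}. \<forall>y\<in>{s..max s R}. w y \<le> w x"
    using s by (intro continuous_attains_sup cont) auto
  then obtain r0 where r0: "s \<le> r0" "\<And>y. s \<le> y \<Longrightarrow> y \<le> max s R \<Longrightarrow> w y \<le> w r0"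
    by auto
  have r0pos: "r0 > 0" using r0 s by linarith
  have max: "w r \<le> w r0" if "r > 0" for r
    using mono[OF that] R[of r] r0(2)[of r] r0(2)[of s] by (cases "r \<le> s"; cases "r \<ge> R") fastforce+
  have w'0: "w' r0 = 0"
    by (rule DERIV_local_max[OF D1[OF r0pos] r0pos]) (auto intro!: max)
  have w''0: "w'' r0 = h r0 * w r0" using ode'[OF r0pos] w'0 by simp
  have "(w r0)\<^sup>2 < \<mu> - real m"
  proof (rule ccontr)
    assume "\<not> ?thesis"
    then have ge: "(w r0)\<^sup>2 \<ge> \<mu> - real m" by simp
    \<comment> \<open>Completing the square shows that \<open>m^2 / r^2 + r^2\<close> is at least
      \<open>2 m\<close>, with equality at \<open>r^2 = m\<close>. The assumption to be refuted then
      forces \<open>h r0 \<ge> 0\<close>.\<close>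
    have sq: "(real m)\<^sup>2 / r\<^sup>2 + r\<^sup>2 = 2 * real m + (r - real m / r)\<^sup>2" if "r > 0" for r
      using that by (simp add: power2_diff power_divide)
    have h0: "h r0 \<ge> (r0 - real m / r0)\<^sup>2"
      using ge sq[OF r0pos] by (simp add: h_def)
    \<comment> \<open>This suffices: by \<open>incr\<close> the profile would rise above its
      maximum. If \<open>h r0 > 0\<close>, continuity gives it; the equality case
      \<open>h r0 = 0\<close> needs a second-order estimate.\<close>
    have "\<exists>e>0. \<forall>r. r0 < r \<and> r < r0 + e \<longrightarrow> h r > 0"
    proof (cases "h r0 > 0")
      case True
      have "isCont h r0"
        unfolding h_def using r0pos by (intro continuous_intros DERIV_isCont[OF D1]) auto
      then have "eventually (\<lambda>r. h r > 0) (at r0)"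
        using True by (auto simp: isCont_def dest: order_tendstoD(1))
      then obtain e where "e > 0" "\<forall>r. r \<noteq> r0 \<and> dist r r0 < e \<longrightarrow> h r > 0"
        by (auto simp: eventually_at)
      then show ?thesis by (intro exI[of _ e]) (auto simp: dist_real_def)
    next
      case False
      then have "(r0 - real m / r0)\<^sup>2 \<le> 0" using h0 by linarith
      then have diff0: "r0 - real m / r0 = 0" by simp
      then have r0m: "real m = r0\<^sup>2" using r0pos by (simp add: field_simps power2_eq_square)
      have "h r0 = 0" using False h0 diff0 by simp
      then have w2: "(w r0)\<^sup>2 = \<mu> - real m"
        using sq[OF r0pos] diff0 by (simp add: h_def)
      \<comment> \<open>The constant makes \<open>k (r - r0)^2 * 2 w(r0)\<close> equal to
        \<open>(r - r0)^2 / 4\<close>, so \<open>2 w^2\<close> drops by at most half of the gain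
        \<open>(r - r0)^2\<close> of the square term in \<open>h\<close>.\<close>
      define k where "k = 1 / (8 * w r0)"
      have k: "k > 0" using pos[OF r0pos] by (simp add: k_def)
      have "w'' r0 = 0" using w''0 \<open>h r0 = 0\<close> by simp
      \<comment> \<open>Because \<open>w' r0 = 0\<close>, this quotient tends to
        \<open>w'' r0 = 0\<close>. The mean value theorem turns \<open>w' = o(r - r0)\<close> into a
        quadratic bound on \<open>w r0 - w r\<close>.\<close>
      then have "((\<lambda>r. w' r / (r - r0)) \<longlongrightarrow> 0) (at r0)"
        using D2[OF r0pos] w'0 by (simp add: has_field_derivative_iff)
      then have "eventually (\<lambda>r. \<bar>w' r / (r - r0)\<bar> < k) (at r0)"
        using k by (auto simp: tendsto_iff)
      then obtain e where e: "e > 0" "\<And>r. r \<noteq> r0 \<Longrightarrow> dist r r0 < e \<Longrightarrow> \<bar>w' r / (r - r0)\<bar> < k"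
        by (auto simp: eventually_at)
      have "h r > 0" if r: "r0 < r" "r < r0 + e" for r
      proof -
        have "\<exists>t>r0. t < r \<and> w r - w r0 = (r - r0) * w' t"
          using r0pos by (intro MVT2[OF r(1)] D1) auto
        then obtain t where t: "r0 < t" "t < r" "w r - w r0 = (r - r0) * w' t" by blast
        have "\<bar>w' t\<bar> < k * (t - r0)"
          using e(2)[of t] t r by (auto simp: dist_real_def field_simps)
        also have "\<dots> \<le> k * (r - r0)" using k t by simp
        finally have "(r - r0) * w' t \<ge> - ((r - r0) * (k * (r - r0)))"
          using r by (smt (verit) mult_left_mono mult_minus_right)
        then have d: "w r0 - w r \<le> k * (r - r0)\<^sup>2"
          using t by (simp add: power2_eq_square algebra_simps)
        have wr: "0 < w r" "w r \<le> w r0" using pos max r r0pos by auto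
        have "(w r0)\<^sup>2 - (w r)\<^sup>2 = (w r0 - w r) * (w r0 + w r)"
          by (simp add: power2_eq_square algebra_simps)
        also have "\<dots> \<le> (k * (r - r0)\<^sup>2) * (2 * w r0)"
          using d wr k by (intro mult_mono) auto
        also have "\<dots> = (r - r0)\<^sup>2 / 4" using wr by (simp add: k_def)
        finally have a: "(w r0)\<^sup>2 - (w r)\<^sup>2 \<le> (r - r0)\<^sup>2 / 4" .
        \<comment> \<open>Here \<open>m = r0^2\<close> and \<open>r > r0\<close> give
          \<open>m / r \<le> r0\<close>.\<close>
        have "r - r0 \<le> r - real m / r"
          using r r0pos by (simp add: r0m power2_eq_square field_simps)
        then have "(r - r0)\<^sup>2 \<le> (r - real m / r)\<^sup>2" using r by (intro power_mono) auto
        moreover have "(r - r0)\<^sup>2 > 0" using r by simp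
        ultimately show "h r > 0" using a w2 sq[of r] r r0pos unfolding h_def by linarith
      qed
      then show ?thesis using e by blast
    qed
    then obtain e where e: "e > 0" "\<And>r. r0 < r \<Longrightarrow> r < r0 + e \<Longrightarrow> h r > 0" by blast
    have "w r0 < w (r0 + e)" using e r0pos w'0 by (intro incr) auto
    then show False using max[of "r0 + e"] e r0pos by simp
  qed
  with that r0pos max show ?thesis by blast
qed

subsection \<open>Test functions and uniqueness of weak derivatives\<close>

lemma pdiff_eqI: "(f has_derivative f') (at x) \<Longrightarrow> pdiff i f x = f' (axis i 1)"
  by (simp add: pdiff_def frechet_derivative_at[symmetric])

lemma pdiff_works:
  "f differentiable (at x) \<Longrightarrow> (f has_derivative frechet_derivative f (at x)) (at x)"
  by (simp add: frechet_derivative_works)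

lemma Ck_continuous: "Ck k f \<Longrightarrow> continuous_on UNIV f"
  by (cases k) (auto intro!: continuous_at_imp_continuous_on differentiable_imp_continuous_within)

lemma Ck_Suc_imp: "Ck (Suc k) f \<Longrightarrow> Ck k f"
proof (induction k arbitrary: f)
  case 0
  then show ?case using Ck_continuous[OF 0] by simp
next
  case (Suc k)
  then show ?case by (metis Ck.simps(2))
qed

lemma Ck_const: "Ck k (\<lambda>x. c)"
proof (induction k arbitrary: c)
  case (Suc k)
  have "pdiff i (\<lambda>x. c) = (\<lambda>x. 0)" for i
    by (intro ext) (subst pdiff_eqI[OF has_derivative_const], simp)
  with Suc show ?case by simp
qed simp

lemma Ck_add: "Ck k f \<Longrightarrow> Ck k g \<Longrightarrow> Ck k (\<lambda>x. f x + g x)"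
proof (induction k arbitrary: f g)
  case (Suc k)
  then have df: "\<And>x. f differentiable (at x)" "\<And>x. g differentiable (at x)" by simp_all
  have "pdiff i (\<lambda>x. f x + g x) = (\<lambda>x. pdiff i f x + pdiff i g x)" for i
    by (intro ext, subst pdiff_eqI[OF has_derivative_add[OF df(1)[THEN pdiff_works] df(2)[THEN pdiff_works]]])
       (simp add: pdiff_def)
  with Suc df show ?case by (simp add: differentiable_add)
qed (simp add: continuous_on_add)

lemma Ck_mult: "Ck k f \<Longrightarrow> Ck k g \<Longrightarrow> Ck k (\<lambda>x. f x * g x)"
proof (induction k arbitrary: f g)
  case (Suc k)
  then have df: "\<And>x. f differentiable (at x)" "\<And>x. g differentiable (at x)" by simp_all
  have "pdiff i (\<lambda>x. f x * g x) = (\<lambda>x. f x * pdiff i g x + pdiff i f x * g x)" for i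
    by (intro ext, subst pdiff_eqI[OF has_derivative_mult[OF df(1)[THEN pdiff_works] df(2)[THEN pdiff_works]]])
       (simp add: pdiff_def)
  then show ?case using Suc df Ck_Suc_imp[of k f] Ck_Suc_imp[of k g]
    by (simp add: differentiable_mult Ck_add del: Ck.simps(1))
qed (simp add: continuous_on_mult)

lemma Ck_inverse: "Ck k f \<Longrightarrow> (\<And>x. f x \<noteq> 0) \<Longrightarrow> Ck k (\<lambda>x. inverse (f x))"
proof (induction k)
  case 0
  then show ?case by (simp add: continuous_on_inverse)
next
  case (Suc k)
  then have df: "\<And>x. f differentiable (at x)" by simp
  \<comment> \<open>Written as a product of functions already known to be \<open>Ck k\<close>, so
    that the induction hypothesis and \<open>Ck_mult\<close> apply.\<close>
  have "pdiff i (\<lambda>x. inverse (f x)) = (\<lambda>x. (- 1) * (inverse (f x) * (pdiff i f x * inverse (f x))))" for i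
    by (intro ext, subst pdiff_eqI[OF Deriv.has_derivative_inverse[OF Suc.prems(2) df[THEN pdiff_works]]])
       (simp add: pdiff_def)
  moreover have "Ck k (\<lambda>x. inverse (f x))" using Suc Ck_Suc_imp by blast
  moreover have "\<And>x. (\<lambda>x. inverse (f x)) differentiable (at x)"
    using df Suc.prems(2) by (intro differentiable_inverse) auto
  ultimately show ?case using Suc.prems(1)
    by (simp only: Ck.simps) (intro conjI allI Ck_mult Ck_const, auto)
qed

section \<open>Smooth bump functions built from \<open>exp (- 1 / t)\<close>\<close>

definition flat_fun :: "real poly \<Rightarrow> real \<Rightarrow> real" where
  "flat_fun p t = (if t > 0 then poly p (1 / t) * exp (- (1 / t)) else 0)"

lemma poly_div_exp_tendsto_0: "((\<lambda>s::real. poly p s / exp s) \<longlongrightarrow> 0) at_top"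
proof -
  have "((\<lambda>s::real. \<Sum>i\<le>degree p. coeff p i * (s ^ i / exp s)) \<longlongrightarrow> (\<Sum>i\<le>degree p. coeff p i * 0)) at_top"
    by (intro tendsto_sum tendsto_mult tendsto_const tendsto_power_div_exp_0)
  then show ?thesis
    by (simp add: poly_altdef sum_divide_distrib)
qed

text \<open>With \<open>s = 1 / t\<close> one has \<open>d/dt = - s^2 d/ds\<close>, which sends
  \<open>p(s) exp(-s)\<close> to \<open>s^2 (p - p') exp(-s)\<close>; \<open>[:0, 0, 1:]\<close> is
  the factor \<open>s^2\<close>. The family is thus closed under differentiation, which yields
  smoothness by induction.\<close>

lemma flat_fun_deriv:
  "(flat_fun p has_real_derivative flat_fun ([:0, 0, 1:] * (p - pderiv p)) t) (at t)"
proof -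
  consider "t > 0" | "t < 0" | "t = 0" by linarith
  then show ?thesis
  proof cases
    case 1
    have "((\<lambda>t. poly p (1 / t) * exp (- (1 / t))) has_real_derivative
        flat_fun ([:0, 0, 1:] * (p - pderiv p)) t) (at t)"
      using 1 by (auto intro!: derivative_eq_intros DERIV_chain2[OF poly_DERIV]
        simp: flat_fun_def field_simps power2_eq_square)
    then show ?thesis
      by (rule has_field_derivative_transform_within_open[of _ _ _ "{0<..}"])
        (use 1 in \<open>auto simp: flat_fun_def\<close>)
  next
    case 2
    have "((\<lambda>t. 0) has_real_derivative flat_fun ([:0, 0, 1:] * (p - pderiv p)) t) (at t)"
      using 2 by (simp add: flat_fun_def)
    then show ?thesis
      by (rule has_field_derivative_transform_within_open[of _ _ _ "{..<0}"])
        (use 2 in \<open>auto simp: flat_fun_def\<close>)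
  next
    case 3
    have "((\<lambda>h. flat_fun p h / h) \<longlongrightarrow> 0) (at_right 0)"
    proof -
      \<comment> \<open>\<open>pCons 0 p\<close> is the polynomial \<open>s p(s)\<close>, whose
        extra factor \<open>s = 1 / h\<close> is the denominator of the difference quotient at
        \<open>0\<close>.\<close>
      have "((\<lambda>h::real. poly (pCons 0 p) (inverse h) / exp (inverse h)) \<longlongrightarrow> 0) (at_right 0)"
        by (rule filterlim_compose[OF poly_div_exp_tendsto_0 filterlim_inverse_at_top_right])
      moreover have "eventually (\<lambda>h. poly (pCons 0 p) (inverse h) / exp (inverse h) = flat_fun p h / h) (at_right (0::real))"
        by (auto simp: eventually_at_filter flat_fun_def exp_minus field_simps)
      ultimately show ?thesis by (rule Lim_transform_eventually)
    qed
    moreover have "((\<lambda>h. flat_fun p h / h) \<longlongrightarrow> 0) (at_left 0)"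
      by (rule tendsto_eventually) (auto simp: eventually_at_filter flat_fun_def)
    ultimately have "((\<lambda>h. flat_fun p h / h) \<longlongrightarrow> 0) (at 0)"
      by (simp add: filterlim_split_at)
    then show ?thesis using 3 by (simp add: DERIV_def flat_fun_def)
  qed
qed

lemma Ck_flat_fun: "Ck k (\<lambda>x. flat_fun p (c * x $ i + d))"
proof (induction k arbitrary: p)
  case 0
  have "continuous_on UNIV (flat_fun p)"
    by (intro continuous_at_imp_continuous_on ballI DERIV_isCont[OF flat_fun_deriv])
  then show ?case
    by (auto intro!: continuous_intros continuous_on_compose2[of UNIV "flat_fun p"])
next
  case (Suc k)
  let ?q = "[:0, 0, 1:] * (p - pderiv p)"
  have D: "((\<lambda>x. flat_fun p (c * x $ i + d)) has_derivative
      (\<lambda>h. flat_fun ?q (c * x $ i + d) * (c * h $ i))) (at x)" for x :: "real^2"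
  proof -
    have "((\<lambda>x::real^2. c * x $ i + d) has_derivative (\<lambda>h. c * h $ i)) (at x)"
      by (auto intro!: derivative_eq_intros simp: bounded_linear_imp_has_derivative bounded_linear_vec_nth)
    from has_derivative_compose[OF this flat_fun_deriv[of p "c * x $ i + d", unfolded has_field_derivative_def]]
    show ?thesis by (simp add: o_def)
  qed
  have "pdiff j (\<lambda>x. flat_fun p (c * x $ i + d)) =
      (\<lambda>x. flat_fun ?q (c * x $ i + d) * (c * axis j 1 $ i))" for j
    by (intro ext, subst pdiff_eqI[OF D]) simp
  then show ?case
    using D by (auto simp: differentiable_def intro!: Ck_mult Ck_const Suc.IH simp del: mult_pCons_left)
qed

text \<open>A smooth \<open>P\<close> that is positive exactly on the box gives
  \<open>P / (P + 1/(n+1))\<close>, which tends to 1 where \<open>P > 0\<close> and vanishes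
  elsewhere; the added constant keeps the denominator positive, so smoothness survives.\<close>

lemma test_function_box_approx:
  fixes a b :: "real^2"
  obtains \<phi> :: "nat \<Rightarrow> real^2 \<Rightarrow> real" where
    "\<And>n. test_function (\<phi> n)"
    "\<And>n x. 0 \<le> \<phi> n x" "\<And>n x. \<phi> n x \<le> indicator (box a b) x"
    "\<And>x. (\<lambda>n. \<phi> n x) \<longlonglongrightarrow> indicator (box a b) x"
proof
  define P :: "real^2 \<Rightarrow> real" where "P = (\<lambda>x.
     (flat_fun 1 (1 * x $ 1 + - (a $ 1)) * flat_fun 1 ((- 1) * x $ 1 + b $ 1)) *
     (flat_fun 1 (1 * x $ 2 + - (a $ 2)) * flat_fun 1 ((- 1) * x $ 2 + b $ 2)))"
  have P0: "P x \<ge> 0" for x by (simp add: P_def flat_fun_def)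
  have Ppos: "P x > 0 \<longleftrightarrow> x \<in> box a b" for x
    by (auto simp: P_def flat_fun_def mem_box_cart forall_2)
  have Pz: "P x = 0 \<longleftrightarrow> x \<notin> box a b" for x using P0[of x] Ppos[of x] by linarith
  define \<phi> where "\<phi> = (\<lambda>n x. P x * inverse (P x + 1 / real (Suc n)))"
  have den: "P x + 1 / real (Suc n) > 0" for x n
    using P0[of x] by (simp add: add_nonneg_pos)
  have "Ck k P" for k
    unfolding P_def by (intro Ck_mult Ck_flat_fun)
  then have Ck: "Ck k (\<phi> n)" for k n
    unfolding \<phi>_def using den[THEN less_imp_neq, THEN not_sym]
    by (intro Ck_mult Ck_inverse Ck_add Ck_const) blast+
  have "compact (closure {x. \<phi> n x \<noteq> 0})" for n
  proof -
    have "{x. \<phi> n x \<noteq> 0} \<subseteq> box a b" using Pz by (auto simp: \<phi>_def)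
    then show ?thesis using bounded_box bounded_subset compact_closure by blast
  qed
  then show "test_function (\<phi> n)" for n
    using Ck by (simp add: test_function_def)
  show "0 \<le> \<phi> n x" for n x
    using P0[of x] den[of x n] by (simp add: \<phi>_def less_imp_le)
  show "\<phi> n x \<le> indicator (box a b) x" for n x
    using P0[of x] den[of x n] Pz[of x] by (auto simp: \<phi>_def field_simps indicator_def)
  show "(\<lambda>n. \<phi> n x) \<longlonglongrightarrow> indicator (box a b) x" for x
  proof (cases "x \<in> box a b")
    case True
    have "(\<lambda>n. P x * inverse (P x + 1 / real (Suc n))) \<longlonglongrightarrow> P x * inverse (P x + 0)"
      using True Ppos[of x] by (intro tendsto_intros LIMSEQ_Suc[OF lim_1_over_n]) auto
    then show ?thesis using True Ppos[of x] by (simp add: \<phi>_def)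
  next
    case False
    then show ?thesis using Pz[of x] by (simp add: \<phi>_def)
  qed
qed

section \<open>Functions with vanishing integrals vanish almost everywhere\<close>

lemma AE_zero_if_box_integrals_zero:
  fixes f :: "'a::euclidean_space \<Rightarrow> real"
  assumes int: "\<And>a b. set_integrable lborel (box a b) f"
    and zero: "\<And>a b. (LINT x:box a b|lborel. f x) = 0"
    and [measurable]: "f \<in> borel_measurable borel"
  shows "AE x in lborel. f x = 0"
proof -
  let ?p = "\<lambda>x. max 0 (f x)" and ?n = "\<lambda>x. max 0 (- f x)"
  have i: "integrable lborel (\<lambda>x. indicator (box a b) x * ?p x)"
      "integrable lborel (\<lambda>x. indicator (box a b) x * ?n x)" for a b
    using int[of a b] unfolding set_integrable_def
    by (auto elim!: Bochner_Integration.integrable_bound simp: indicator_def)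
  have em: "emeasure (density lborel (\<lambda>x. ennreal (g x))) (box a b) =
      ennreal (LINT x|lborel. indicator (box a b) x * g x)"
    if [measurable]: "g \<in> borel_measurable borel" and "\<And>x. g x \<ge> 0"
      "integrable lborel (\<lambda>x. indicator (box a b) x * g x)" for g a b
    using that by (simp add: emeasure_density mult.commute nn_integral_eq_integral[symmetric] ennreal_mult' ennreal_indicator)
  have eq: "(LINT x|lborel. indicator (box a b) x * ?p x) = (LINT x|lborel. indicator (box a b) x * ?n x)" for a b
  proof -
    have "(LINT x|lborel. indicator (box a b) x * ?p x) - (LINT x|lborel. indicator (box a b) x * ?n x)
        = (LINT x|lborel. indicator (box a b) x * f x)"
      by (subst Bochner_Integration.integral_diff[OF i, symmetric])
         (auto intro!: Bochner_Integration.integral_cong simp: max_def indicator_def)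
    then show ?thesis using zero[of a b] by (simp add: set_lebesgue_integral_def)
  qed
  \<comment> \<open>The positive and negative parts define measures that agree on boxes, an
    intersection-stable generator with finite measure on an exhausting sequence; equal measures have
    almost everywhere equal densities.\<close>
  have "density lborel (\<lambda>x. ennreal (?p x)) = density lborel (\<lambda>x. ennreal (?n x))"
  proof (rule measure_eqI_generator_eq[where E="range (\<lambda>(a,b). box a b)" and \<Omega>=UNIV
        and A="\<lambda>n::nat. box (- (real n *\<^sub>R One)) (real n *\<^sub>R One)"])
    show "Int_stable (range (\<lambda>(a,b). box a b :: 'a set))"
      by (auto simp: Int_stable_def box_Int_box)
    show "emeasure (density lborel (\<lambda>x. ennreal (?p x))) X = emeasure (density lborel (\<lambda>x. ennreal (?n x))) X"
      if "X \<in> range (\<lambda>(a,b). box a b)" for X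
      using that by (auto simp: em i eq)
    show "emeasure (density lborel (\<lambda>x. ennreal (?p x))) (box (- (real n *\<^sub>R One)) (real n *\<^sub>R One)) \<noteq> \<infinity>" for n
      by (simp add: em i)
    show "(\<Union>n::nat. box (- (real n *\<^sub>R One)) (real n *\<^sub>R One)) = (UNIV :: 'a set)"
      by (rule UN_box_eq_UNIV)
  qed (auto simp: borel_eq_box)
  then have "AE x in lborel. ennreal (?p x) = ennreal (?n x)"
    by (intro sigma_finite_measure.density_unique[OF lborel.sigma_finite_measure_axioms]) auto
  then show ?thesis
    by eventually_elim (auto simp: max_def split: if_splits)
qed

text \<open>The fundamental lemma of the calculus of variations: dominated convergence along the box
  approximations reduces it to integrals over boxes.\<close>

lemma AE_zero_if_test_integrals_zero:
  fixes f :: "real^2 \<Rightarrow> real"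
  assumes [measurable]: "f \<in> borel_measurable borel"
    and int: "\<And>a b. set_integrable lborel (box a b) f"
    and zero: "\<And>\<phi>. test_function \<phi> \<Longrightarrow> (LINT x|lborel. \<phi> x * f x) = 0"
  shows "AE x in lborel. f x = 0"
proof (rule AE_zero_if_box_integrals_zero)
  fix a b :: "real^2"
  obtain \<phi> where test: "\<And>n. test_function (\<phi> n)"
    and \<phi>: "\<And>n x. 0 \<le> \<phi> n x" "\<And>n x. \<phi> n x \<le> indicator (box a b) x"
      "\<And>x. (\<lambda>n. \<phi> n x) \<longlonglongrightarrow> indicator (box a b) x"
    using test_function_box_approx by metis
  have [measurable]: "\<phi> n \<in> borel_measurable borel" for n
    using test[of n] Ck_continuous by (auto simp: test_function_def intro!: borel_measurable_continuous_onI)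
  have "(\<lambda>n. LINT x|lborel. \<phi> n x * f x) \<longlonglongrightarrow> (LINT x|lborel. indicator (box a b) x * f x)"
  proof (rule integral_dominated_convergence[where w="\<lambda>x. norm (indicator (box a b) x * f x)"])
    show "integrable lborel (\<lambda>x. norm (indicator (box a b) x * f x))"
      using int[of a b] by (simp add: set_integrable_def)
    show "AE x in lborel. norm (\<phi> n x * f x) \<le> norm (indicator (box a b) x * f x)" for n
      using \<phi>(1,2)[of n] by (intro AE_I2) (auto simp: abs_mult intro!: mult_right_mono)
    show "AE x in lborel. (\<lambda>n. \<phi> n x * f x) \<longlonglongrightarrow> indicator (box a b) x * f x"
      by (intro AE_I2 tendsto_mult \<phi>(3) tendsto_const)
  qed auto
  then show "(LINT x:box a b|lborel. f x) = 0"
    by (simp add: zero[OF test] set_lebesgue_integral_def LIMSEQ_const_iff)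
qed (use int in auto)

section \<open>Weak derivatives of square-integrable fields\<close>

lemma integrable_scaleR_L2:
  assumes G: "G \<in> L2" and [measurable]: "\<phi> \<in> borel_measurable borel"
    and \<phi>: "integrable lborel (\<lambda>x. (\<phi> x :: real)\<^sup>2)"
  shows "integrable lborel (\<lambda>x. \<phi> x *\<^sub>R G x)"
proof (rule Bochner_Integration.integrable_bound)
  have [measurable]: "G \<in> borel_measurable borel" using G by (simp add: L2_def)
  show "(\<lambda>x. \<phi> x *\<^sub>R G x) \<in> borel_measurable lborel" by simp
  show "integrable lborel (\<lambda>x. (\<phi> x)\<^sup>2 + (norm (G x))\<^sup>2)"
    using G \<phi> by (auto simp: L2_def)
  have "\<bar>\<phi> x\<bar> * norm (G x) \<le> (\<phi> x)\<^sup>2 + (norm (G x))\<^sup>2" for x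
    using sum_squares_bound[of "\<bar>\<phi> x\<bar>" "norm (G x)"]
      mult_nonneg_nonneg[OF abs_ge_zero[of "\<phi> x"] norm_ge_zero[of "G x"]] unfolding power2_abs by linarith
  then show "AE x in lborel. norm (\<phi> x *\<^sub>R G x) \<le> norm ((\<phi> x)\<^sup>2 + (norm (G x))\<^sup>2)"
    by simp
qed

text \<open>Supplies the hypotheses of \<open>integrable_scaleR_L2\<close>, so that the integrals in
  \<open>is_weak_pdiff\<close> may be treated linearly.\<close>

lemma test_function_square_integrable:
  assumes "test_function \<phi>"
  shows "\<phi> \<in> borel_measurable borel" "integrable lborel (\<lambda>x. (\<phi> x)\<^sup>2)"
proof -
  have c: "continuous_on UNIV \<phi>"
    using assms Ck_continuous by (auto simp: test_function_def)
  then show "\<phi> \<in> borel_measurable borel" by (rule borel_measurable_continuous_onI)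
  let ?K = "closure {x. \<phi> x \<noteq> 0}"
  have "integrable lborel (\<lambda>x. indicator ?K x *\<^sub>R (\<phi> x)\<^sup>2)"
    using assms c by (intro borel_integrable_compact) (auto simp: test_function_def intro!: continuous_intros intro: continuous_on_subset)
  moreover have "indicator ?K x *\<^sub>R (\<phi> x)\<^sup>2 = (\<phi> x)\<^sup>2" for x
    using closure_subset[of "{x. \<phi> x \<noteq> 0}"] by (auto simp: indicator_def)
  ultimately show "integrable lborel (\<lambda>x. (\<phi> x)\<^sup>2)" by (simp only:)
qed

lemma test_function_pdiff:
  assumes "test_function \<phi>"
  shows "test_function (pdiff i \<phi>)"
proof -
  have "Ck k (pdiff i \<phi>)" for k
    using assms unfolding test_function_def by (metis Ck.simps(2))
  moreover have "pdiff i \<phi> x = 0" if "x \<notin> closure {x. \<phi> x \<noteq> 0}" for x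
  \<comment> \<open>Off the closed support, \<open>\<phi>\<close> vanishes on an open neighbourhood,
    hence so does its derivative.\<close>
  proof -
    have "((\<lambda>x. 0) has_derivative (\<lambda>h. 0)) (at x)" by simp
    then have "(\<phi> has_derivative (\<lambda>h. 0)) (at x)"
      by (rule has_derivative_transform_within_open[of _ _ _ _ "- closure {x. \<phi> x \<noteq> 0}"])
        (use that closure_subset[of "{x. \<phi> x \<noteq> 0}"] in auto)
    then show ?thesis by (simp add: pdiff_eqI)
  qed
  then have "closure {x. pdiff i \<phi> x \<noteq> 0} \<subseteq> closure {x. \<phi> x \<noteq> 0}"
    by (intro closure_minimal) auto
  then have "compact (closure {x. pdiff i \<phi> x \<noteq> 0})"
    using assms unfolding test_function_def by (meson closed_closure compact_closure bounded_subset compact_imp_bounded closure_subset subset_trans)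
  ultimately show ?thesis by (simp add: test_function_def)
qed

lemma weak_pdiff_unique:
  assumes G: "G \<in> L2" "is_weak_pdiff i \<Psi> G" and H: "H \<in> L2" "is_weak_pdiff i \<Psi> H"
  shows "AE x in lborel. G x = H x"
proof -
  have [measurable]: "G \<in> borel_measurable borel" "H \<in> borel_measurable borel"
    using G H by (auto simp: L2_def)
  \<comment> \<open>The real-valued criterion is applied to each coordinate of
    \<open>complex^2\<close> as a real Euclidean space; its basis is finite, so the null sets
    combine.\<close>
  have "AE x in lborel. (G x - H x) \<bullet> u = 0" if "u \<in> Basis" for u
  proof (rule AE_zero_if_test_integrals_zero)
    have intS: "integrable lborel (\<lambda>x. \<phi> x * ((G x - H x) \<bullet> u))"
      if [measurable]: "\<phi> \<in> borel_measurable borel" and "integrable lborel (\<lambda>x. (\<phi> x :: real)\<^sup>2)" for \<phi>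
    proof -
      have "integrable lborel (\<lambda>x. (\<phi> x *\<^sub>R G x - \<phi> x *\<^sub>R H x) \<bullet> u)"
        using that by (intro integrable_inner_left Bochner_Integration.integrable_diff integrable_scaleR_L2 G H) auto
      then show ?thesis by (simp add: inner_diff_left right_diff_distrib)
    qed
    show "set_integrable lborel (box a b) (\<lambda>x. (G x - H x) \<bullet> u)" for a b
    proof -
      have "(indicator (box a b) x :: real)\<^sup>2 = indicator (box a b) x" for x
        by (simp add: indicator_def)
      then show ?thesis unfolding set_integrable_def real_scaleR_def
        by (intro intS) (simp_all add: integrable_indicator_iff emeasure_lborel_box_finite[unfolded infinity_ennreal_def])
    qed
    fix \<phi> assume t: "test_function \<phi>"
    note tf = test_function_square_integrable[OF t]
    note ig = integrable_scaleR_L2[OF G(1) tf] and ih = integrable_scaleR_L2[OF H(1) tf]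
    have "(LINT x|lborel. \<phi> x *\<^sub>R G x) = (LINT x|lborel. \<phi> x *\<^sub>R H x)"
      using G(2) H(2) t by (simp add: is_weak_pdiff_def)
    then have "(LINT x|lborel. \<phi> x *\<^sub>R G x - \<phi> x *\<^sub>R H x) = 0"
      by (simp add: ig ih)
    then have "(LINT x|lborel. (\<phi> x *\<^sub>R G x - \<phi> x *\<^sub>R H x) \<bullet> u) = 0"
      by (subst integral_inner_left) (auto intro: ig ih)
    then show "(LINT x|lborel. \<phi> x * ((G x - H x) \<bullet> u)) = 0"
      by (simp add: inner_diff_left right_diff_distrib)
  qed auto
  then have "AE x in lborel. \<forall>u\<in>Basis. (G x - H x) \<bullet> u = 0"
    by (intro AE_finite_allI) auto
  then show ?thesis
    by eventually_elim (simp add: euclidean_all_zero_iff)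
qed

subsection \<open>The eigenvalue bound\<close>

lemma Jmat_mult: "Jmat *v v = vector [- (v $ 2), v $ 1]"
  by (simp add: Jmat_def matrix_vector_mult_def vec_eq_iff forall_2 sum_2)

lemma norm_vec2_square: "(norm (v :: complex^2))\<^sup>2 = (norm (v $ 1))\<^sup>2 + (norm (v $ 2))\<^sup>2"
  by (simp add: norm_vec_def L2_set_def sum_2)

lemma norm_Jmat_mult: "norm (Jmat *v v) = norm v"
proof -
  have "(norm (Jmat *v v))\<^sup>2 = (norm v)\<^sup>2"
    by (simp add: norm_vec2_square Jmat_mult)
  then show ?thesis by simp
qed

text \<open>The product is \<open>v2 * cnj v1\<close> minus its own conjugate, hence purely
  imaginary.\<close>

lemma Re_cdot_Jmat: "Re (cdot v (Jmat *v v)) = 0"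
  by (simp add: cdot_def sum_2 Jmat_mult)

lemma norm_cdot_le: "norm (cdot u v) \<le> (norm u)\<^sup>2 + (norm v)\<^sup>2"
proof -
  have p: "norm (a * cnj b) \<le> (norm a)\<^sup>2 + (norm b)\<^sup>2" for a b :: complex
    using sum_squares_bound[of "norm a" "norm b"]
      mult_nonneg_nonneg[OF norm_ge_zero[of a] norm_ge_zero[of b]]
    unfolding norm_mult complex_mod_cnj by linarith
  have "norm (cdot u v) \<le> norm (u $ 1 * cnj (v $ 1)) + norm (u $ 2 * cnj (v $ 2))"
    by (simp add: cdot_def sum_2 norm_triangle_ineq)
  then show ?thesis
    using p[of "u $ 1" "v $ 1"] p[of "u $ 2" "v $ 2"] by (simp add: norm_vec2_square)
qed

lemma Jmat_L2:
  assumes "\<Psi> \<in> L2" shows "(\<lambda>x. Jmat *v \<Psi> x) \<in> L2"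
proof -
  have "((*v) Jmat :: complex^2 \<Rightarrow> _) \<in> borel_measurable borel"
    by (intro borel_measurable_continuous_onI linear_continuous_on matrix_vector_mul_bounded_linear)
  from measurable_compose[OF _ this] show ?thesis
    using assms by (auto simp: L2_def norm_Jmat_mult)
qed

text \<open>A constant matrix is a bounded linear map and passes through the integrals, which
  converge by square integrability.\<close>

lemma is_weak_pdiff_Jmat:
  assumes \<Psi>: "\<Psi> \<in> L2" and G: "G \<in> L2" and wd: "is_weak_pdiff i \<Psi> G"
  shows "is_weak_pdiff i (\<lambda>x. Jmat *v \<Psi> x) (\<lambda>x. Jmat *v G x)"
  unfolding is_weak_pdiff_def
proof (intro allI impI)
  fix \<phi> assume t: "test_function \<phi>"
  have J: "(LINT x|lborel. \<phi> x *\<^sub>R (Jmat *v F x)) = Jmat *v (LINT x|lborel. \<phi> x *\<^sub>R F x)"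
    if "F \<in> L2" "\<phi> \<in> borel_measurable borel" "integrable lborel (\<lambda>x. (\<phi> x)\<^sup>2)" for F \<phi>
    using integral_bounded_linear[OF matrix_vector_mul_bounded_linear[of Jmat] integrable_scaleR_L2[OF that]]
    by (simp add: linear_scale[OF matrix_vector_mul_linear])
  have Jm: "Jmat *v (- v) = - (Jmat *v v)" for v
    by (simp add: linear_neg[OF matrix_vector_mul_linear])
  show "(LINT x|lborel. pdiff i \<phi> x *\<^sub>R (Jmat *v \<Psi> x)) = - (LINT x|lborel. \<phi> x *\<^sub>R (Jmat *v G x))"
    using wd t by (simp add: J \<Psi> G test_function_square_integrable[OF t]
      test_function_square_integrable[OF test_function_pdiff[OF t]] is_weak_pdiff_def Jm)
qed

lemma weak_pdiff_H1:
  assumes "\<Psi> \<in> H1"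
  shows "weak_pdiff i \<Psi> \<in> L2" "is_weak_pdiff i \<Psi> (weak_pdiff i \<Psi>)"
proof -
  have "\<exists>G. G \<in> L2 \<and> is_weak_pdiff i \<Psi> G" using assms by (auto simp: H1_def)
  from someI_ex[OF this] show "weak_pdiff i \<Psi> \<in> L2" "is_weak_pdiff i \<Psi> (weak_pdiff i \<Psi>)"
    by (auto simp: weak_pdiff_def)
qed

text \<open>Makes \<open>J \<Psi>\<close> admissible as second argument in the identity that defines
  \<open>L_c\<close>.\<close>

lemma Jmat_form_domain:
  assumes "\<Psi> \<in> form_domain"
  shows "(\<lambda>x. Jmat *v \<Psi> x) \<in> form_domain"
proof -
  have \<Psi>: "\<Psi> \<in> H1" "\<Psi> \<in> L2" using assms by (auto simp: form_domain_def H1_def)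
  have "(\<lambda>x. Jmat *v (norm x *\<^sub>R \<Psi> x)) \<in> L2"
    using assms by (intro Jmat_L2) (auto simp: form_domain_def)
  then have "(\<lambda>x. norm x *\<^sub>R (Jmat *v \<Psi> x)) \<in> L2"
    by (simp add: linear_scale[OF matrix_vector_mul_linear])
  moreover have "(\<lambda>x. Jmat *v \<Psi> x) \<in> H1"
    unfolding H1_def using Jmat_L2[OF \<Psi>(2)] Jmat_L2[OF weak_pdiff_H1(1)[OF \<Psi>(1)]]
      is_weak_pdiff_Jmat[OF \<Psi>(2) weak_pdiff_H1[OF \<Psi>(1)]] by blast
  ultimately show ?thesis by (simp add: form_domain_def)
qed

text \<open>\<open>weak_pdiff\<close> is a choice of representative, so it commutes with
  \<open>J\<close> only up to a null set, through uniqueness.\<close>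

lemma AE_weak_pdiff_Jmat:
  assumes "\<Psi> \<in> H1" "(\<lambda>x. Jmat *v \<Psi> x) \<in> H1"
  shows "AE x in lborel. weak_pdiff i (\<lambda>x. Jmat *v \<Psi> x) x = Jmat *v weak_pdiff i \<Psi> x"
proof (rule weak_pdiff_unique)
  have "\<Psi> \<in> L2" using assms by (simp add: H1_def)
  with assms weak_pdiff_H1[OF assms(1)]
  show "is_weak_pdiff i (\<lambda>x. Jmat *v \<Psi> x) (\<lambda>x. Jmat *v weak_pdiff i \<Psi> x)"
    by (intro is_weak_pdiff_Jmat)
qed (use assms weak_pdiff_H1 Jmat_L2 in auto)

lemma Re_q_form_Jmat:
  assumes "\<Psi> \<in> form_domain"
  shows "Re (q_form \<Psi> (\<lambda>x. Jmat *v \<Psi> x)) = 0"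
proof -
  let ?f = "\<lambda>x. (1/2) * (\<Sum>i\<in>UNIV. cdot (weak_pdiff i \<Psi> x) (weak_pdiff i (\<lambda>x. Jmat *v \<Psi> x) x))
     + of_real ((norm x)\<^sup>2 / 2) * cdot (\<Psi> x) (Jmat *v \<Psi> x)"
  have H1: "\<Psi> \<in> H1" "(\<lambda>x. Jmat *v \<Psi> x) \<in> H1"
    using assms Jmat_form_domain by (auto simp: form_domain_def)
  \<comment> \<open>After commuting \<open>J\<close> with the derivatives, every term is a real
    multiple of some \<open>cdot v (J v)\<close>.\<close>
  have AE: "AE x in lborel. Re (?f x) = 0"
    using AE_weak_pdiff_Jmat[OF H1, of 1] AE_weak_pdiff_Jmat[OF H1, of 2]
    by eventually_elim (simp add: sum_2 Re_cdot_Jmat)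
  show ?thesis
  proof (cases "integrable lborel ?f")
    case True
    then have "Re (integral\<^sup>L lborel ?f) = (LINT x|lborel. Re (?f x))"
      by (rule integral_Re[symmetric])
    also have "\<dots> = 0" by (rule integral_eq_zero_AE[OF AE])
    finally show ?thesis unfolding q_form_def .
  next
    \<comment> \<open>The Bochner integral of a non-integrable function is \<open>0\<close> by
      convention, so the claim holds here too.\<close>
    case False
    then show ?thesis unfolding q_form_def by (simp add: not_integrable_integral_eq)
  qed
qed

text \<open>Testing the form identity with \<open>J \<Psi>\<close> equates this integral with the
  real part of \<open>q(\<Psi>, J \<Psi>)\<close>; integrability comes from both factors lying in
  \<open>L2\<close>.\<close>

lemma Re_L2_inner_Jmat:
  assumes "L_c \<Psi> F"
  shows "integrable lborel (\<lambda>x. Re (cdot (F x) (Jmat *v \<Psi> x)))"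
    "(LINT x|lborel. Re (cdot (F x) (Jmat *v \<Psi> x))) = 0"
proof -
  have \<Psi>: "\<Psi> \<in> form_domain" and F: "F \<in> L2"
    and eq: "q_form \<Psi> (\<lambda>x. Jmat *v \<Psi> x) = L2_inner F (\<lambda>x. Jmat *v \<Psi> x)"
    using assms Jmat_form_domain by (auto simp: L_c_def form_operator_def)
  have \<Psi>2: "\<Psi> \<in> L2" "(\<lambda>x. Jmat *v \<Psi> x) \<in> L2"
    using \<Psi> Jmat_L2 by (auto simp: form_domain_def H1_def)
  have int: "integrable lborel (\<lambda>x. cdot (F x) (Jmat *v \<Psi> x))"
  proof (rule Bochner_Integration.integrable_bound)
    show "integrable lborel (\<lambda>x. (norm (F x))\<^sup>2 + (norm (Jmat *v \<Psi> x))\<^sup>2)"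
      using F \<Psi>2 by (auto simp: L2_def)
    have "continuous_on UNIV (\<lambda>p. cdot (fst p) (snd p))"
      unfolding cdot_def by (intro continuous_intros)
    then have c: "(\<lambda>p. cdot (fst p) (snd p)) \<in> borel_measurable (borel :: ((complex^2) \<times> (complex^2)) measure)"
      by (rule borel_measurable_continuous_onI)
    have "(\<lambda>x. (F x, Jmat *v \<Psi> x)) \<in> borel_measurable lborel"
      using F \<Psi>2 by (intro borel_measurable_Pair) (auto simp: L2_def)
    from measurable_compose[OF this c]
    show "(\<lambda>x. cdot (F x) (Jmat *v \<Psi> x)) \<in> borel_measurable lborel" by simp
    show "AE x in lborel. norm (cdot (F x) (Jmat *v \<Psi> x)) \<le> norm ((norm (F x))\<^sup>2 + (norm (Jmat *v \<Psi> x))\<^sup>2)"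
      by (intro AE_I2) (simp add: norm_cdot_le)
  qed
  then show "integrable lborel (\<lambda>x. Re (cdot (F x) (Jmat *v \<Psi> x)))" by (rule integrable_Re)
  show "(LINT x|lborel. Re (cdot (F x) (Jmat *v \<Psi> x))) = 0"
    using integral_Re[OF int] Re_q_form_Jmat[OF \<Psi>] by (simp add: eq L2_inner_def)
qed

text \<open>
  Only the reflection part of \<open>L_w\<close> contributes: the scalar part \<open>2 w\<^sup>2 - \<mu>\<close> is killed because
  \<open>J\<close> is antisymmetric.
\<close>

lemma Re_eigen_pointwise:
  assumes eq: "z *s v = - (Jmat *v (f + L_w m \<mu> w x *v v))"
  shows "\<bar>Re z * (norm v)\<^sup>2 - Re (cdot f (Jmat *v v))\<bar> \<le> 2 * (w (norm x))\<^sup>2 * (norm v)\<^sup>2"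
proof -
  let ?t = "2 * real m * polar_angle x" and ?s = "(w (norm x))\<^sup>2"
  define c s where "c = cos ?t" and "s = sin ?t"
  \<comment> \<open>The rotation by \<open>?t\<close> times \<open>R\<close> is the reflection with
    rows \<open>(c, s)\<close> and \<open>(s, -c)\<close>.\<close>
  have L: "L_w m \<mu> w x *v v = vector [
      of_real (2 * ?s - \<mu>) * v $ 1 + of_real ?s * (of_real c * v $ 1 + of_real s * v $ 2),
      of_real (2 * ?s - \<mu>) * v $ 2 + of_real ?s * (of_real s * v $ 1 - of_real c * v $ 2)]"
    unfolding L_w_def mat_exp_Jmat c_def[symmetric] s_def[symmetric]
    by (simp add: Jmat_def Rmat_def matrix_matrix_mult_def matrix_vector_mult_def mat_def
        vec_eq_iff forall_2 sum_2 scaleR_conv_of_real[where 'a=complex] algebra_simps)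
  have e: "z * v $ 1 = f $ 2 + (L_w m \<mu> w x *v v) $ 2" "z * v $ 2 = - (f $ 1 + (L_w m \<mu> w x *v v) $ 1)"
    using arg_cong[OF eq, of "\<lambda>u. u $ 1"] arg_cong[OF eq, of "\<lambda>u. u $ 2"]
    by (simp_all add: Jmat_mult)
  have "Re z * (norm v)\<^sup>2 = Re (z * v $ 1 * cnj (v $ 1) + z * v $ 2 * cnj (v $ 2))"
    unfolding norm_vec2_square cmod_power2 by (simp add: algebra_simps power2_eq_square)
  also have "\<dots> = Re (cdot f (Jmat *v v)) +
      ?s * (s * ((norm (v $ 1))\<^sup>2 - (norm (v $ 2))\<^sup>2) - 2 * c * (Re (v $ 1) * Re (v $ 2) + Im (v $ 1) * Im (v $ 2)))"
    unfolding e L cmod_power2 by (simp add: cdot_def sum_2 Jmat_mult algebra_simps power2_eq_square)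
  finally have diff: "Re z * (norm v)\<^sup>2 - Re (cdot f (Jmat *v v)) =
      ?s * (s * ((norm (v $ 1))\<^sup>2 - (norm (v $ 2))\<^sup>2) - c * (2 * (Re (v $ 1) * Re (v $ 2) + Im (v $ 1) * Im (v $ 2))))"
    by simp
  \<comment> \<open>The sine and cosine terms are bounded separately by \<open>(norm v)^2\<close>;
    their sum gives the factor 2.\<close>
  have abs_le: "\<bar>a * b\<bar> \<le> N" if "\<bar>a\<bar> \<le> 1" "\<bar>b\<bar> \<le> N" for a b N :: real
    using mult_mono[OF that] by (simp add: abs_mult)
  have cs: "\<bar>c\<bar> \<le> 1" "\<bar>s\<bar> \<le> 1" unfolding c_def s_def by (rule abs_cos_le_one, rule abs_sin_le_one)
  have "\<bar>(norm (v $ 1))\<^sup>2 - (norm (v $ 2))\<^sup>2\<bar> \<le> (norm v)\<^sup>2"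
    unfolding norm_vec2_square by (simp add: abs_le_iff)
  from abs_le[OF cs(2) this]
  have "\<bar>s * ((norm (v $ 1))\<^sup>2 - (norm (v $ 2))\<^sup>2)\<bar> \<le> (norm v)\<^sup>2" .
  moreover have "\<bar>2 * (Re (v $ 1) * Re (v $ 2) + Im (v $ 1) * Im (v $ 2))\<bar> \<le> (norm v)\<^sup>2"
    using zero_le_power2[of "Re (v $ 1) - Re (v $ 2)"] zero_le_power2[of "Im (v $ 1) - Im (v $ 2)"]
      zero_le_power2[of "Re (v $ 1) + Re (v $ 2)"] zero_le_power2[of "Im (v $ 1) + Im (v $ 2)"]
    unfolding norm_vec2_square cmod_power2 abs_le_iff power2_diff power2_sum mult.assoc distrib_left
    by (intro conjI) linarith+
  from abs_le[OF cs(1) this]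
  have "\<bar>c * (2 * (Re (v $ 1) * Re (v $ 2) + Im (v $ 1) * Im (v $ 2)))\<bar> \<le> (norm v)\<^sup>2" .
  ultimately have "\<bar>s * ((norm (v $ 1))\<^sup>2 - (norm (v $ 2))\<^sup>2) - c * (2 * (Re (v $ 1) * Re (v $ 2) + Im (v $ 1) * Im (v $ 2)))\<bar>
      \<le> 2 * (norm v)\<^sup>2" by linarith
  then have "?s * \<bar>s * ((norm (v $ 1))\<^sup>2 - (norm (v $ 2))\<^sup>2) - c * (2 * (Re (v $ 1) * Re (v $ 2) + Im (v $ 1) * Im (v $ 2)))\<bar>
      \<le> ?s * (2 * (norm v)\<^sup>2)" by (intro mult_left_mono) auto
  then show ?thesis unfolding diff abs_mult by (simp add: mult_ac)
qed

section \<open>Integrated estimate and conclusion\<close>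

lemma eigenvalue_Re_bound:
  assumes ev: "eigenvalue (lin_op m \<mu> w) z" and M: "\<And>r. r > 0 \<Longrightarrow> (w r)\<^sup>2 \<le> M"
  shows "\<bar>Re z\<bar> \<le> 2 * M"
proof -
  obtain \<Psi> F where \<Psi>: "\<Psi> \<in> L2" "\<not> (AE x in lborel. \<Psi> x = 0)" and F: "L_c \<Psi> F"
    and eq: "AE x in lborel. z *s \<Psi> x = - (Jmat *v (F x + L_w m \<mu> w x *v \<Psi> x))"
    using ev by (auto simp: eigenvalue_def lin_op_def)
  let ?N = "LINT x|lborel. (norm (\<Psi> x))\<^sup>2"
  let ?g = "\<lambda>x. Re (cdot (F x) (Jmat *v \<Psi> x))"
  have int: "integrable lborel (\<lambda>x. (norm (\<Psi> x))\<^sup>2)" using \<Psi> by (simp add: L2_def)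
  note g = Re_L2_inner_Jmat[OF F]
  \<comment> \<open>\<open>M\<close> bounds \<open>w^2\<close> only for positive radius; the origin
    is a null set.\<close>
  have "AE x in lborel. x \<noteq> (0 :: real^2)" by (rule AE_lborel_singleton)
  with eq have "AE x in lborel. norm (Re z * (norm (\<Psi> x))\<^sup>2 - ?g x) \<le> 2 * M * (norm (\<Psi> x))\<^sup>2"
  proof eventually_elim
    case (elim x)
    have "2 * (w (norm x))\<^sup>2 * (norm (\<Psi> x))\<^sup>2 \<le> 2 * M * (norm (\<Psi> x))\<^sup>2"
      using M[of "norm x"] elim by (intro mult_right_mono) auto
    with Re_eigen_pointwise[OF elim(1)] show ?case by simp
  qed
  moreover have diff: "integrable lborel (\<lambda>x. Re z * (norm (\<Psi> x))\<^sup>2 - ?g x)"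
    by (intro Bochner_Integration.integrable_diff integrable_mult_right int g(1))
  ultimately have "(LINT x|lborel. norm (Re z * (norm (\<Psi> x))\<^sup>2 - ?g x)) \<le> (LINT x|lborel. 2 * M * (norm (\<Psi> x))\<^sup>2)"
    by (intro integral_mono_AE integrable_norm integrable_mult_right int)
  then have "norm (LINT x|lborel. Re z * (norm (\<Psi> x))\<^sup>2 - ?g x) \<le> (LINT x|lborel. 2 * M * (norm (\<Psi> x))\<^sup>2)"
    by (rule order_trans[OF integral_norm_bound])
  \<comment> \<open>The pairing with \<open>J \<Psi>\<close> integrates to zero by
    \<open>g(2)\<close>, leaving the squared norm of \<open>\<Psi>\<close>.\<close>
  also have "(LINT x|lborel. Re z * (norm (\<Psi> x))\<^sup>2 - ?g x) = Re z * ?N"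
    by (subst Bochner_Integration.integral_diff) (use int g in simp_all)
  finally have "\<bar>Re z\<bar> * ?N \<le> 2 * M * ?N" by (simp add: abs_mult)
  moreover have "?N > 0"
  proof -
    have "?N \<noteq> 0" using \<Psi>(2) int by (subst integral_nonneg_eq_0_iff_AE) auto
    then show ?thesis by (simp add: order_less_le)
  qed
  ultimately show ?thesis by simp
qed

text \<open>Membership of \<open>M\<close> in the image expresses that the maximum is attained. With
  \<open>M = (w r0)^2 > 0\<close>, the bound \<open>2 M\<close> lies strictly below
  \<open>3 M\<close>.\<close>

theorem proposition5:
  fixes m :: nat and \<mu> :: real and w :: "real \<Rightarrow> real"
  assumes "m \<ge> 1"
    and "vortex_profile m \<mu> w"
  shows "\<exists>M. M \<in> (\<lambda>r. \<bar>w r\<bar>\<^sup>2) ` {0<..} \<and> (\<forall>r>0. \<bar>w r\<bar>\<^sup>2 \<le> M) \<and>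
    (\<forall>z. eigenvalue (lin_op m \<mu> w) z \<longrightarrow> \<bar>Re z\<bar> < 3 * M) \<and>
    3 * M < 3 * (\<mu> - real m)"
proof -
  obtain r0 where r0: "r0 > 0" "\<And>r. r > 0 \<Longrightarrow> w r \<le> w r0" "(w r0)\<^sup>2 < \<mu> - real m"
    using vortex_profile_max[OF assms] by blast
  have pos: "w r > 0" if "r > 0" for r using assms(2) that by (simp add: vortex_profile_def)
  have le: "(w r)\<^sup>2 \<le> (w r0)\<^sup>2" if "r > 0" for r
    using r0(2)[OF that] pos[OF that] by (intro power_mono) auto
  have "\<bar>Re z\<bar> < 3 * (w r0)\<^sup>2" if "eigenvalue (lin_op m \<mu> w) z" for z
  proof -
    have "\<bar>Re z\<bar> \<le> 2 * (w r0)\<^sup>2" using eigenvalue_Re_bound[OF that le] by blast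
    also have "\<dots> < 3 * (w r0)\<^sup>2" using pos[OF r0(1)] by simp
    finally show ?thesis .
  qed
  with r0 le show ?thesis by (intro exI[of _ "(w r0)\<^sup>2"]) auto
qed

end
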